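(* Let $A$ be a Jacobi-Jordan (JJ) algebra over a field $k$, $E$ a vector space and $\pi:E\to A$ an epimorphism of vector spaces with $V=\mathrm{Ker}(\pi)$. Then any JJ algebra structure $\cdot_E$ which can be defined on the vector space $E$ such that $\pi:(E,\cdot_E)\to A$ becomes a morphism of JJ algebras is isomorphic to a crossed product $A\#V=A\#_{(\triangleright,\vartheta,\cdot_V)}V$. Furthermore, the isomorphism of JJ algebras $(E,\cdot_E)\cong A\#V$ can be chosen such that it stabilizes $V$ and co-stabilizes $A$. Therefore, any JJ algebra structure on $E$ such that $\pi:E\to A$ is a JJ algebra map is cohomologous to an extension of the form $$0\to V\xrightarrow{\,i_V\,}A\#V\xrightarrow{\,\pi_A\,}A\to 0,\qquad i_V(x)=(0,x),\ \ \pi_A(a,x)=a.$$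
   Context: $k$ is an arbitrary field. A JJ algebra is a $k$-vector space $A$ with a bilinear map $\cdot:A\times A\to A$ such that $a\cdot b=b\cdot a$ and $a\cdot(b\cdot c)+b\cdot(c\cdot a)+c\cdot(a\cdot b)=0$; morphisms are multiplicative linear maps. Given a JJ algebra $A$ and a vector space $V$, a crossed system of $A$ by $V$ is a triple $(\triangleright,\vartheta,\cdot_V)$ of bilinear maps $\triangleright:A\times V\to V$, $\vartheta:A\times A\to V$, $\cdot_V:V\times V\to V$ such that $A\times V$ with multiplication $(a,x)\bullet(b,y):=(a\cdot b,\ \vartheta(a,b)+a\triangleright y+b\triangleright x+x\cdot_V y)$ is a JJ algebra; this JJ algebra is then called the crossed product and denoted $A\#V=A\#_{(\triangleright,\vartheta,\cdot_V)}V$. An isomorphism $\varphi:A\#V\to(E,\cdot_E)$ (or its inverse) stabilizes $V$ if $\varphi(0,x)=x$ for all $x\in V$, and co-stabilizes $A$ if $\pi(\varphi(a,x))=a$ for all $a\in A$, $x\in V$; "cohomologous" means related by a JJ algebra map that stabilizes $V$ and co-stabilizes $A$. *)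

theory Defs
  imports "HOL-Analysis.Product_Vector"
begin

text \<open>
  A vector space over the field \<open>'k\<close> is given by a scalar multiplication \<open>s\<close> on an ambient type with
  \<open>vector_space s\<close>, together with a carrier that is a subspace. Carriers are needed because
  \<open>V = Ker \<pi>\<close> and \<open>A \<times> V\<close> are not types; all conditions are relative to them.
\<close>

definition linear_on ::
  "('k::field \<Rightarrow> 'a::ab_group_add \<Rightarrow> 'a) \<Rightarrow> 'a set \<Rightarrow> ('k \<Rightarrow> 'b::ab_group_add \<Rightarrow> 'b) \<Rightarrow> 'b set
    \<Rightarrow> ('a \<Rightarrow> 'b) \<Rightarrow> bool"
  where
  "linear_on s1 S s2 T f \<longleftrightarrow>
     (\<forall>x\<in>S. f x \<in> T) \<and>
     (\<forall>x\<in>S. \<forall>y\<in>S. f (x + y) = f x + f y) \<and>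
     (\<forall>c. \<forall>x\<in>S. f (s1 c x) = s2 c (f x))"

definition bilinear_on ::
  "('k::field \<Rightarrow> 'a::ab_group_add \<Rightarrow> 'a) \<Rightarrow> 'a set \<Rightarrow> ('k \<Rightarrow> 'b::ab_group_add \<Rightarrow> 'b) \<Rightarrow> 'b set
    \<Rightarrow> ('k \<Rightarrow> 'c::ab_group_add \<Rightarrow> 'c) \<Rightarrow> 'c set \<Rightarrow> ('a \<Rightarrow> 'b \<Rightarrow> 'c) \<Rightarrow> bool"
  where
  "bilinear_on s1 S s2 T s3 U f \<longleftrightarrow>
     (\<forall>x\<in>S. linear_on s2 T s3 U (f x)) \<and>
     (\<forall>y\<in>T. linear_on s1 S s3 U (\<lambda>x. f x y))"

definition jj_algebra ::
  "('k::field \<Rightarrow> 'a::ab_group_add \<Rightarrow> 'a) \<Rightarrow> 'a set \<Rightarrow> ('a \<Rightarrow> 'a \<Rightarrow> 'a) \<Rightarrow> bool"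
  where
  "jj_algebra s A m \<longleftrightarrow>
     vector_space s \<and> module.subspace s A \<and>
     bilinear_on s A s A s A m \<and>
     (\<forall>a\<in>A. \<forall>b\<in>A. m a b = m b a) \<and>
     (\<forall>a\<in>A. \<forall>b\<in>A. \<forall>c\<in>A. m a (m b c) + m b (m c a) + m c (m a b) = 0)"

definition jj_hom ::
  "('k::field \<Rightarrow> 'a::ab_group_add \<Rightarrow> 'a) \<Rightarrow> 'a set \<Rightarrow> ('a \<Rightarrow> 'a \<Rightarrow> 'a)
    \<Rightarrow> ('k \<Rightarrow> 'b::ab_group_add \<Rightarrow> 'b) \<Rightarrow> 'b set \<Rightarrow> ('b \<Rightarrow> 'b \<Rightarrow> 'b) \<Rightarrow> ('a \<Rightarrow> 'b) \<Rightarrow> bool"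
  where
  "jj_hom s1 A m1 s2 B m2 f \<longleftrightarrow>
     linear_on s1 A s2 B f \<and> (\<forall>x\<in>A. \<forall>y\<in>A. f (m1 x y) = m2 (f x) (f y))"

definition jj_iso ::
  "('k::field \<Rightarrow> 'a::ab_group_add \<Rightarrow> 'a) \<Rightarrow> 'a set \<Rightarrow> ('a \<Rightarrow> 'a \<Rightarrow> 'a)
    \<Rightarrow> ('k \<Rightarrow> 'b::ab_group_add \<Rightarrow> 'b) \<Rightarrow> 'b set \<Rightarrow> ('b \<Rightarrow> 'b \<Rightarrow> 'b) \<Rightarrow> ('a \<Rightarrow> 'b) \<Rightarrow> bool"
  where
  "jj_iso s1 A m1 s2 B m2 f \<longleftrightarrow> jj_hom s1 A m1 s2 B m2 f \<and> bij_betw f A B"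

definition crossed_mult ::
  "('a \<Rightarrow> 'a \<Rightarrow> 'a) \<Rightarrow> ('a \<Rightarrow> 'v \<Rightarrow> 'v) \<Rightarrow> ('a \<Rightarrow> 'a \<Rightarrow> 'v) \<Rightarrow> ('v \<Rightarrow> 'v \<Rightarrow> 'v)
    \<Rightarrow> 'a \<times> 'v \<Rightarrow> 'a \<times> 'v \<Rightarrow> 'a \<times> ('v::ab_group_add)"
  where
  "crossed_mult mA act \<theta> mV = (\<lambda>(a, x) (b, y). (mA a b, \<theta> a b + act a y + act b x + mV x y))"

text \<open>\<open>module_prod.scale sA sV\<close> is the componentwise scalar multiplication on pairs.\<close>

definition crossed_system ::
  "('k::field \<Rightarrow> 'a::ab_group_add \<Rightarrow> 'a) \<Rightarrow> 'a set \<Rightarrow> ('a \<Rightarrow> 'a \<Rightarrow> 'a)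
    \<Rightarrow> ('k \<Rightarrow> 'v::ab_group_add \<Rightarrow> 'v) \<Rightarrow> 'v set
    \<Rightarrow> ('a \<Rightarrow> 'v \<Rightarrow> 'v) \<Rightarrow> ('a \<Rightarrow> 'a \<Rightarrow> 'v) \<Rightarrow> ('v \<Rightarrow> 'v \<Rightarrow> 'v) \<Rightarrow> bool"
  where
  "crossed_system sA A mA sV V act \<theta> mV \<longleftrightarrow>
     jj_algebra sA A mA \<and> vector_space sV \<and> module.subspace sV V \<and>
     bilinear_on sA A sV V sV V act \<and>
     bilinear_on sA A sA A sV V \<theta> \<and>
     bilinear_on sV V sV V sV V mV \<and>
     jj_algebra (module_prod.scale sA sV) (A \<times> V) (crossed_mult mA act \<theta> mV)"

text \<open>
  For spaces \<open>E\<close>, \<open>E'\<close> with maps \<open>i : V \<rightarrow> E\<close>, \<open>i' : V \<rightarrow> E'\<close> and \<open>p : E \<rightarrow> A\<close>, \<open>p' : E' \<rightarrow> A\<close>,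
  a map \<open>f : E \<rightarrow> E'\<close> stabilizes \<open>V\<close> if \<open>f \<circ> i = i'\<close> and co-stabilizes \<open>A\<close> if \<open>p' \<circ> f = p\<close>.
\<close>

definition stabilizes :: "'v set \<Rightarrow> ('v \<Rightarrow> 'e) \<Rightarrow> ('v \<Rightarrow> 'f) \<Rightarrow> ('e \<Rightarrow> 'f) \<Rightarrow> bool"
  where "stabilizes V i i' f \<longleftrightarrow> (\<forall>x\<in>V. f (i x) = i' x)"

definition costabilizes :: "'e set \<Rightarrow> ('e \<Rightarrow> 'a) \<Rightarrow> ('f \<Rightarrow> 'a) \<Rightarrow> ('e \<Rightarrow> 'f) \<Rightarrow> bool"
  where "costabilizes E p p' f \<longleftrightarrow> (\<forall>z\<in>E. p' (f z) = p z)"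

definition jj_extension ::
  "('k::field \<Rightarrow> 'v::ab_group_add \<Rightarrow> 'v) \<Rightarrow> 'v set \<Rightarrow> ('v \<Rightarrow> 'v \<Rightarrow> 'v) \<Rightarrow> ('v \<Rightarrow> 'e)
    \<Rightarrow> ('k \<Rightarrow> 'e::ab_group_add \<Rightarrow> 'e) \<Rightarrow> 'e set \<Rightarrow> ('e \<Rightarrow> 'e \<Rightarrow> 'e) \<Rightarrow> ('e \<Rightarrow> 'a)
    \<Rightarrow> ('k \<Rightarrow> 'a::ab_group_add \<Rightarrow> 'a) \<Rightarrow> 'a set \<Rightarrow> ('a \<Rightarrow> 'a \<Rightarrow> 'a) \<Rightarrow> bool"
  where
  "jj_extension sV V mV i sE E mE p sA A mA \<longleftrightarrow>
     jj_algebra sV V mV \<and> jj_algebra sE E mE \<and> jj_algebra sA A mA \<and>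
     jj_hom sV V mV sE E mE i \<and> jj_hom sE E mE sA A mA p \<and>
     inj_on i V \<and> i ` V = {z \<in> E. p z = 0} \<and> p ` E = A"

definition cohomologous ::
  "'v set \<Rightarrow> ('v \<Rightarrow> 'e)
    \<Rightarrow> ('k::field \<Rightarrow> 'e::ab_group_add \<Rightarrow> 'e) \<Rightarrow> 'e set \<Rightarrow> ('e \<Rightarrow> 'e \<Rightarrow> 'e) \<Rightarrow> ('e \<Rightarrow> 'a)
    \<Rightarrow> ('v \<Rightarrow> 'f)
    \<Rightarrow> ('k \<Rightarrow> 'f::ab_group_add \<Rightarrow> 'f) \<Rightarrow> 'f set \<Rightarrow> ('f \<Rightarrow> 'f \<Rightarrow> 'f) \<Rightarrow> ('f \<Rightarrow> 'a) \<Rightarrow> bool"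
  where
  "cohomologous V i sE E mE p i' sF F mF p' \<longleftrightarrow>
     (\<exists>f. jj_hom sE E mE sF F mF f \<and> stabilizes V i i' f \<and> costabilizes E p p' f)"

end

theory Submission
  imports Defs
begin

text \<open>
  Choose a linear section \<open>s\<close> of \<open>\<pi>\<close>. Then \<open>\<phi> (a, x) = s a + x\<close> is a linear bijection from
  \<open>A \<times> V\<close> onto \<open>E\<close> with inverse \<open>z \<mapsto> (\<pi> z, z - s (\<pi> z))\<close>. Since \<open>V\<close> is an ideal of \<open>E\<close>, the data
  \<open>a \<triangleright> x = s a \<cdot> x\<close>, \<open>\<theta>(a, b) = s a \<cdot> s b - s (a \<cdot> b)\<close> and the restriction of the product to \<open>V\<close>
  take values in \<open>V\<close>, and their crossed product is the pullback of the product of \<open>E\<close> along \<open>\<phi>\<close>.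
  The identities of a JJ algebra transfer along \<open>\<phi>\<close>.
\<close>

text \<open>Since \<open>f\<close> is injective, an equation in \<open>B\<close> can be tested after
  applying \<open>f\<close>, where it becomes the corresponding law of \<open>A\<close>. The same
  argument serves for the bijection \<phi> and for the inclusion of the kernel \<open>V\<close> into
  \<open>E\<close>.\<close>

lemma jj_algebra_pullback:
  fixes f :: "'b::ab_group_add \<Rightarrow> 'a::ab_group_add"
  assumes alg: "jj_algebra s A m"
    and vs: "vector_space s'" and sub: "module.subspace s' B"
    and lin: "linear_on s' B s A f" and inj: "inj_on f B"
    and closed: "\<And>x y. x \<in> B \<Longrightarrow> y \<in> B \<Longrightarrow> n x y \<in> B"
    and mult: "\<And>x y. x \<in> B \<Longrightarrow> y \<in> B \<Longrightarrow> f (n x y) = m (f x) (f y)"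
  shows "jj_algebra s' B n"
proof -
  have mod: "module s'" using vs by (simp add: module_iff_vector_space)
  note B_simps = module.subspace_0[OF mod sub] module.subspace_add[OF mod sub]
    module.subspace_scale[OF mod sub] closed
  have f_mem: "f x \<in> A" if "x \<in> B" for x
    using lin that by (simp add: linear_on_def)
  have f_add: "f (x + y) = f x + f y" if "x \<in> B" "y \<in> B" for x y
    using lin that by (simp add: linear_on_def)
  have f_scale: "f (s' c x) = s c (f x)" if "x \<in> B" for c x
    using lin that by (simp add: linear_on_def)
  have f_zero: "f 0 = 0"
    using f_add[of 0 0] B_simps(1) by simp
  note f_simps = f_mem f_add f_scale f_zero mult
  have m_lin: "m a (b + c) = m a b + m a c" "m (b + c) a = m b a + m c a"
    if "a \<in> A" "b \<in> A" "c \<in> A" for a b c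
    using alg that unfolding jj_algebra_def bilinear_on_def linear_on_def by blast+
  have m_scale: "m a (s r b) = s r (m a b)" "m (s r b) a = s r (m b a)"
    if "a \<in> A" "b \<in> A" for a b r
    using alg that unfolding jj_algebra_def bilinear_on_def linear_on_def by blast+
  have m_commute: "m a b = m b a" if "a \<in> A" "b \<in> A" for a b
    using alg that unfolding jj_algebra_def by blast
  have m_jacobi: "m a (m b c) + m b (m c a) + m c (m a b) = 0"
    if "a \<in> A" "b \<in> A" "c \<in> A" for a b c
    using alg that unfolding jj_algebra_def by blast
  have eqI: "x = y" if "f x = f y" "x \<in> B" "y \<in> B" for x y
    using inj that by (rule inj_onD)
  have "bilinear_on s' B s' B s' B n"
    unfolding bilinear_on_def linear_on_def
    by (intro conjI ballI allI) (auto intro!: eqI simp: B_simps f_simps m_lin m_scale)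
  moreover have "n x y = n y x" if "x \<in> B" "y \<in> B" for x y
    by (rule eqI) (use that in \<open>simp_all add: B_simps f_simps m_commute[of "f x" "f y"]\<close>)
  moreover have "n x (n y z) + n y (n z x) + n z (n x y) = 0"
    if "x \<in> B" "y \<in> B" "z \<in> B" for x y z
    by (rule eqI) (use that in \<open>simp_all add: B_simps f_simps m_jacobi\<close>)
  ultimately show ?thesis
    using vs sub by (simp add: jj_algebra_def)
qed

lemma linear_on_inv_into:
  assumes lin: "linear_on s1 A s2 B f" and bij: "bij_betw f A B"
    and mod: "module s1" and sub: "module.subspace s1 A"
  shows "linear_on s2 B s1 A (inv_into A f)"
proof -
  have inv_mem: "inv_into A f y \<in> A" and f_inv: "f (inv_into A f y) = y" if "y \<in> B" for y
    using bij that by (auto simp: bij_betw_def inv_into_into f_inv_into_f)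
  have inv_eq: "inv_into A f (f x) = x" if "x \<in> A" for x
    using bij that by (simp add: bij_betw_def)
  \<comment> \<open>\<open>f\<close> sends the sum of the two preimages to \<open>y + z\<close>, so
    the left inverse law at that sum gives the claim; scalars and, in the next lemma, products are
    treated alike.\<close>
  have "inv_into A f (y + z) = inv_into A f y + inv_into A f z" if "y \<in> B" "z \<in> B" for y z
    using lin inv_eq[of "inv_into A f y + inv_into A f z"] that
    by (simp add: linear_on_def inv_mem f_inv module.subspace_add[OF mod sub])
  moreover have "inv_into A f (s2 c y) = s1 c (inv_into A f y)" if "y \<in> B" for c y
    using lin inv_eq[of "s1 c (inv_into A f y)"] that
    by (simp add: linear_on_def inv_mem f_inv module.subspace_scale[OF mod sub])
  ultimately show ?thesis
    by (simp add: linear_on_def inv_mem)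
qed

text \<open>Cohomology is stated by a map from \<open>E\<close> to the crossed product, while \<phi>
  runs the other way; this turns \<phi> around.\<close>

lemma jj_hom_inv_into:
  assumes iso: "jj_iso s1 A m1 s2 B m2 f" and alg: "jj_algebra s1 A m1"
  shows "jj_hom s2 B m2 s1 A m1 (inv_into A f)"
proof -
  have lin: "linear_on s1 A s2 B f" and bij: "bij_betw f A B"
    and mult: "\<And>x y. x \<in> A \<Longrightarrow> y \<in> A \<Longrightarrow> f (m1 x y) = m2 (f x) (f y)"
    using iso by (simp_all add: jj_iso_def jj_hom_def)
  have closed: "m1 x y \<in> A" if "x \<in> A" "y \<in> A" for x y
    using alg that by (simp add: jj_algebra_def bilinear_on_def linear_on_def)
  have inv_mem: "inv_into A f y \<in> A" and f_inv: "f (inv_into A f y) = y" if "y \<in> B" for y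
    using bij that by (auto simp: bij_betw_def inv_into_into f_inv_into_f)
  have inv_eq: "inv_into A f (f x) = x" if "x \<in> A" for x
    using bij that by (simp add: bij_betw_def)
  have "inv_into A f (m2 y z) = m1 (inv_into A f y) (inv_into A f z)" if "y \<in> B" "z \<in> B" for y z
    using inv_eq[of "m1 (inv_into A f y) (inv_into A f z)"] that
    by (simp add: mult inv_mem f_inv closed)
  moreover have "linear_on s2 B s1 A (inv_into A f)"
    using lin bij alg by (intro linear_on_inv_into) (simp_all add: jj_algebra_def module_iff_vector_space)
  ultimately show ?thesis by (simp add: jj_hom_def)
qed

theorem proposition2p4:
  fixes sA :: "'k::field \<Rightarrow> 'a::ab_group_add \<Rightarrow> 'a"
    and mA :: "'a \<Rightarrow> 'a \<Rightarrow> 'a"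
    and sE :: "'k \<Rightarrow> 'e::ab_group_add \<Rightarrow> 'e"
    and mE :: "'e \<Rightarrow> 'e \<Rightarrow> 'e"
    and \<pi> :: "'e \<Rightarrow> 'a"
    and V :: "'e set"
  assumes "jj_algebra sA UNIV mA"
    and "vector_space sE"
    and "Vector_Spaces.linear sE sA \<pi>" and "surj \<pi>"
    and "V = {x. \<pi> x = 0}"
    and "jj_algebra sE UNIV mE"
    and "jj_hom sE UNIV mE sA UNIV mA \<pi>"
  shows "\<exists>act \<theta> mV.
    crossed_system sA UNIV mA sE V act \<theta> mV \<and>
    (\<exists>\<phi>. jj_iso (module_prod.scale sA sE) (UNIV \<times> V) (crossed_mult mA act \<theta> mV) sE UNIV mE \<phi> \<and>
         stabilizes V (\<lambda>x. (0, x)) (\<lambda>x. x) \<phi> \<and>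
         costabilizes (UNIV \<times> V) fst \<pi> \<phi>) \<and>
    jj_extension sE V mV (\<lambda>x. (0, x))
      (module_prod.scale sA sE) (UNIV \<times> V) (crossed_mult mA act \<theta> mV) fst sA UNIV mA \<and>
    cohomologous V (\<lambda>x. x) sE UNIV mE \<pi>
      (\<lambda>x. (0, x)) (module_prod.scale sA sE) (UNIV \<times> V) (crossed_mult mA act \<theta> mV) fst"
proof -
  note A = assms(1) and E = assms(6) and V_def = assms(5)
  \<comment> \<open>\<open>E\<close> comes first here, so \<open>vs1\<close> is the space
    \<open>E\<close> that contains \<open>V\<close>; in the product \<open>P\<close> the factor
    \<open>A\<close> comes first.\<close>
  interpret vector_space_pair sE sA
    using A assms(2) by (simp add: vector_space_pair_def jj_algebra_def)
  interpret P: vector_space_prod sA sE by unfold_locales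
  interpret \<pi>: Vector_Spaces.linear sE sA \<pi> by (fact assms(3))
  \<comment> \<open>The section is linear but in general not multiplicative; \<theta> will measure
    its failure to respect products.\<close>
  obtain s where s_lin: "Vector_Spaces.linear sA sE s" and "\<pi> \<circ> s = id"
    using linear_surjective_right_inverse[OF assms(3,4)] by blast
  then have \<pi>_s: "\<pi> (s a) = a" for a
    by (simp add: pointfree_idE)
  interpret s: Vector_Spaces.linear sA sE s by (fact s_lin)

  have mE: "mE x (y + z) = mE x y + mE x z" "mE (x + y) z = mE x z + mE y z"
    "mE x (sE c y) = sE c (mE x y)" "mE (sE c x) y = sE c (mE x y)" for x y z c
    using E unfolding jj_algebra_def bilinear_on_def linear_on_def by blast+
  have mE_commute: "mE x y = mE y x" for x y
    using E by (simp add: jj_algebra_def)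
  have mA: "mA x (y + z) = mA x y + mA x z" "mA (x + y) z = mA x z + mA y z"
    "mA x (sA c y) = sA c (mA x y)" "mA (sA c x) y = sA c (mA x y)" for x y z c
    using A unfolding jj_algebra_def bilinear_on_def linear_on_def by blast+
  \<comment> \<open>With \<open>\<pi>_mult\<close> this makes \<open>V\<close> an ideal: a product
    with a factor in the kernel is mapped to 0.\<close>
  have mA_0: "mA x 0 = 0" "mA 0 x = 0" for x
    using mA(1)[of x 0 0] mA(2)[of 0 0 x] by simp_all
  have \<pi>_mult: "\<pi> (mE x y) = mA (\<pi> x) (\<pi> y)" for x y
    using assms(7) by (simp add: jj_hom_def)

  have V_sub: "vs1.subspace V"
    unfolding V_def by (rule \<pi>.subspace_kernel)
  have V_iff: "x \<in> V \<longleftrightarrow> \<pi> x = 0" for x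
    by (simp add: V_def)

  define act where "act = (\<lambda>a x. mE (s a) x)"
  define \<theta> where "\<theta> = (\<lambda>a b. mE (s a) (s b) - s (mA a b))"
  define \<phi> where "\<phi> = (\<lambda>(a, x). s a + x)"
  let ?S = "UNIV \<times> V" and ?mult = "crossed_mult mA act \<theta> mE"
  note data_defs = act_def \<theta>_def \<phi>_def crossed_mult_def

  have S_sub: "P.p.subspace ?S"
    using V_sub by (intro P.subspace_Times) simp_all
  have \<phi>_lin: "linear_on P.scale ?S sE UNIV \<phi>"
    by (auto simp: linear_on_def \<phi>_def P.scale_def s.add s.scale vs1.scale_right_distrib)
  have \<phi>_bij: "bij_betw \<phi> ?S UNIV"
    by (rule bij_betw_byWitness[where f' = "\<lambda>z. (\<pi> z, z - s (\<pi> z))"])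
      (auto simp: \<phi>_def V_iff \<pi>.add \<pi>.diff \<pi>_s)
  \<comment> \<open>In the second component, \<theta> is killed by \<pi> because \<open>s\<close> is
    a section, and every other term has a factor in \<open>V\<close>.\<close>
  have closed: "?mult p q \<in> ?S" if "p \<in> ?S" "q \<in> ?S" for p q
    using that by (auto simp: data_defs V_iff \<pi>.add \<pi>.diff \<pi>_mult \<pi>_s mA_0)
  \<comment> \<open>Expand \<open>mE (s a + x) (s b + y)\<close>. Commutativity turns the term
    \<open>mE x (s b)\<close> into \<open>act b x\<close>, and the \<open>s (mA a b)\<close>
    subtracted in \<theta> cancels the image of the first component.\<close>
  have \<phi>_mult: "\<phi> (?mult p q) = mE (\<phi> p) (\<phi> q)" for p q
  proof -
    obtain a x b y where "p = (a, x)" "q = (b, y)" by fastforce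
    then show ?thesis
      by (simp add: data_defs mE mE_commute[of x "s b"] algebra_simps)
  qed

  have crossed_alg: "jj_algebra P.scale ?S ?mult"
    by (rule jj_algebra_pullback[OF E P.p.vector_space_axioms S_sub \<phi>_lin])
      (use \<phi>_bij closed \<phi>_mult in \<open>simp_all add: bij_betw_def\<close>)
  have V_alg: "jj_algebra sE V mE"
    by (rule jj_algebra_pullback[OF E assms(2) V_sub, where f = "\<lambda>x. x"])
      (simp_all add: linear_on_def V_iff \<pi>_mult mA_0)
  have system: "crossed_system sA UNIV mA sE V act \<theta> mE"
  proof -
    have "bilinear_on sA UNIV sE V sE V act"
      by (auto simp: bilinear_on_def linear_on_def act_def V_iff \<pi>_mult mA_0 mE s.add s.scale)
    moreover have "bilinear_on sA UNIV sA UNIV sE V \<theta>"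
      by (auto simp: bilinear_on_def linear_on_def \<theta>_def V_iff \<pi>.diff \<pi>_mult \<pi>_s mE mA
          s.add s.scale vs1.scale_right_diff_distrib)
    moreover have "bilinear_on sE V sE V sE V mE"
      using V_alg by (simp add: jj_algebra_def)
    ultimately show ?thesis
      using A assms(2) V_sub crossed_alg by (simp add: crossed_system_def)
  qed

  have iso: "jj_iso P.scale ?S ?mult sE UNIV mE \<phi>"
    using \<phi>_lin \<phi>_bij \<phi>_mult by (simp add: jj_iso_def jj_hom_def)
  have stab: "stabilizes V (\<lambda>x. (0, x)) (\<lambda>x. x) \<phi>"
    by (simp add: stabilizes_def \<phi>_def)
  have costab: "costabilizes ?S fst \<pi> \<phi>"
    by (auto simp: costabilizes_def \<phi>_def V_iff \<pi>.add \<pi>_s)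

  have extension: "jj_extension sE V mE (\<lambda>x. (0, x)) P.scale ?S ?mult fst sA UNIV mA"
  proof -
    \<comment> \<open>For pairs with first component 0, both actions and \<theta> vanish because
      \<open>s 0 = 0\<close>, which leaves the product of \<open>V\<close>.\<close>
    have "mE 0 x = 0" "mE x 0 = 0" for x
      using mE(1)[of x 0 0] mE(2)[of 0 0 x] by simp_all
    then have "jj_hom sE V mE P.scale ?S ?mult (\<lambda>x. (0, x))"
      by (simp add: jj_hom_def linear_on_def P.scale_def data_defs mA_0)
    moreover have "jj_hom P.scale ?S ?mult sA UNIV mA fst"
      by (auto simp: jj_hom_def linear_on_def P.scale_def crossed_mult_def)
    moreover have "fst ` ?S = UNIV"
      using vs1.subspace_0[OF V_sub] by force
    ultimately show ?thesis
      using V_alg crossed_alg A by (auto simp: jj_extension_def inj_on_def)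
  qed

  have "cohomologous V (\<lambda>x. x) sE UNIV mE \<pi> (\<lambda>x. (0, x)) P.scale ?S ?mult fst"
    unfolding cohomologous_def
  proof (intro exI conjI)
    \<comment> \<open>Both compatibilities are inherited from \<phi>:
      \<open>?\<psi> x = ?\<psi> (\<phi> (0, x)) = (0, x)\<close> for \<open>x\<close> in
      \<open>V\<close>, and
      \<open>fst (?\<psi> z) = \<pi> (\<phi> (?\<psi> z)) = \<pi> z\<close>.\<close>
    let ?\<psi> = "inv_into ?S \<phi>"
    show "jj_hom sE UNIV mE P.scale ?S ?mult ?\<psi>"
      using iso crossed_alg by (rule jj_hom_inv_into)
    have "?\<psi> (\<phi> p) = p" if "p \<in> ?S" for p
      using \<phi>_bij that by (rule bij_betw_inv_into_left)
    then show "stabilizes V (\<lambda>x. x) (\<lambda>x. (0, x)) ?\<psi>"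
      using stab unfolding stabilizes_def by (metis UNIV_I mem_Sigma_iff)
    have "?\<psi> z \<in> ?S" "\<phi> (?\<psi> z) = z" for z
      using \<phi>_bij by (auto simp: bij_betw_def intro!: inv_into_into f_inv_into_f)
    then show "costabilizes UNIV \<pi> fst ?\<psi>"
      using costab unfolding costabilizes_def by metis
  qed
  with system iso stab costab extension show ?thesis
    by blast
qed

end
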